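(* Let $k$ be a field and let $\mathcal{D}$ be a weighted oriented graph that is the union of two distinct oriented cycles $\mathcal{C}_m$ and $\mathcal{C}_n$ (together with a connecting path in case (C)), satisfying one of the following: (A) $\mathcal{C}_m$ and $\mathcal{C}_n$ share exactly a single vertex (and no edges); (B) the set $E(\mathcal{C}_m)\cap E(\mathcal{C}_n)$ induces an oriented path with at least one edge, and $V(\mathcal{C}_m)\cap V(\mathcal{C}_n)$ is the vertex set of this path; (C) $\mathcal{C}_m$ and $\mathcal{C}_n$ are vertex-disjoint and are connected by an oriented path $\mathcal{P}_s$ of length $s\geq 1$, which meets $\mathcal{C}_m$ in exactly one of its endpoints and $\mathcal{C}_n$ in exactly its other endpoint. Suppose that the toric ideal $I_{\mathcal{D}}$ is generated by a single irreducible binomial $f$. If one of the cycles $\mathcal{C}$ of $\mathcal{D}$ is balanced, then $\operatorname{supp} f=E(\mathcal{C})$. Otherwise, $\operatorname{supp} f=E(\mathcal{D})$. (In cases (A) and (C) the cycles of $\mathcal{D}$ are $\mathcal{C}_m$ and $\mathcal{C}_n$; in case (B) there are three cycles: $\mathcal{C}_m$, $\mathcal{C}_n$, and the outer cycle with edge set the symmetric difference of $E(\mathcal{C}_m)$ and $E(\mathcal{C}_n)$.)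
   Context: Weighted oriented graph: $\mathcal{D}$ is a finite simple graph with vertices $x_1,\dots,x_\nu$ and edges $e_1,\dots,e_\mu$, each edge given one orientation ($(x_p,x_q)$ denotes an edge directed from $x_p$ to $x_q$), together with positive integer vertex weights $w_1,\dots,w_\nu$. The toric ideal $I_{\mathcal{D}}$ is the kernel of the $k$-algebra homomorphism $k[e_1,\dots,e_\mu]\to k[x_1,\dots,x_\nu]$ sending an edge $e=(x_p,x_q)$ to $x_p x_q^{w_q}$. The incidence matrix $A(\mathcal{D})=(a_{i,j})$ is the $\nu\times\mu$ matrix with $a_{i,j}=1$ if $e_j$ is directed out of $x_i$, $a_{i,j}=w_i$ if $e_j$ is directed into $x_i$, and $a_{i,j}=0$ otherwise. For a binomial $f=\prod_i e_i^{r_i}-\prod_i e_i^{s_i}$ (with $r_i$ and $s_i$ not both non-zero for any $i$), the support $\operatorname{supp} f$ is the set of variables (edges) $e_i$ occurring in $f$ with non-zero exponent. Oriented cycles and oriented paths are weighted oriented graphs whose underlying unoriented graph is a cycle (on at least three vertices) or a path; the edges may be oriented arbitrarily. The length of a path is its number of edges. A weighted oriented cycle on $n$ vertices, labeled so that $e_i$ joins $x_i$ and $x_{i+1}$ for $1\le i\le n$ with $x_{n+1}=x_1$, is balanced if $n$ is even and $\prod_{i=1}^{n}a_{i,i}=a_{1,n}\prod_{i=1}^{n-1}a_{i+1,i}$, where $(a_{i,j})$ is its incidence matrix. A cycle contained in a weighted oriented graph is balanced if it is balanced with the inherited orientation and weights. *)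

theory Defs
  imports HOL.Modules "HOL-Library.Poly_Mapping" "HOL-Computational_Algebra.Factorial_Ring"
begin

section \<open>Weighted oriented graphs\<close>

text \<open>
  The vertices \<open>x\<^sub>1, \<dots>, x\<^sub>\<nu>\<close> are the elements of a finite type \<open>'v\<close> and the edges
  \<open>e\<^sub>1, \<dots>, e\<^sub>\<mu>\<close> those of a finite type \<open>'e\<close>, so that the polynomial rings
  \<open>k[x\<^sub>1, \<dots>, x\<^sub>\<nu>]\<close> and \<open>k[e\<^sub>1, \<dots>, e\<^sub>\<mu>]\<close> are types.
  The edge \<open>e\<close> is \<open>(x\<^sub>p, x\<^sub>q)\<close> for \<open>tail D e = x\<^sub>p\<close> and \<open>head D e = x\<^sub>q\<close>.
\<close>

record ('v, 'e) wo_graph =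
  tail :: "'e \<Rightarrow> 'v"
  head :: "'e \<Rightarrow> 'v"
  weight :: "'v \<Rightarrow> nat"

definition ends :: "('v, 'e) wo_graph \<Rightarrow> 'e \<Rightarrow> 'v set" where
  "ends D e = {tail D e, head D e}"

definition weighted_oriented_graph :: "('v::finite, 'e::finite) wo_graph \<Rightarrow> bool" where
  "weighted_oriented_graph D \<longleftrightarrow>
     (\<forall>e. tail D e \<noteq> head D e) \<and> inj (ends D) \<and> (\<forall>v. weight D v > 0)"

definition incidence :: "('v, 'e) wo_graph \<Rightarrow> 'v \<Rightarrow> 'e \<Rightarrow> nat" where
  "incidence D v e =
     (if v = tail D e then 1 else if v = head D e then weight D v else 0)"


section \<open>Cycles and paths\<close>

text \<open>
  Cycles and paths in \<open>D\<close> have no isolated vertices, so they are given by their edge sets;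
  \<open>verts D F\<close> is the vertex set of the subgraph with edge set \<open>F\<close>.  Orientation and weights
  are those of \<open>D\<close>.  The predicates below ignore the orientation of the edges.
\<close>

definition verts :: "('v, 'e) wo_graph \<Rightarrow> 'e set \<Rightarrow> 'v set" where
  "verts D F = (\<Union>e\<in>F. ends D e)"

text \<open>
  The labels start at \<open>0\<close>: \<open>es ! i\<close> joins \<open>vs ! i\<close> and \<open>vs ! (i + 1)\<close>, in a cycle with
  indices taken modulo the length.
\<close>

definition cycle_labelling :: "('v, 'e) wo_graph \<Rightarrow> 'v list \<Rightarrow> 'e list \<Rightarrow> bool" where
  "cycle_labelling D vs es \<longleftrightarrow>
     length vs \<ge> 3 \<and> length es = length vs \<and> distinct vs \<and>
     (\<forall>i < length vs. ends D (es ! i) = {vs ! i, vs ! (Suc i mod length vs)})"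

definition oriented_cycle :: "('v, 'e) wo_graph \<Rightarrow> 'e set \<Rightarrow> bool" where
  "oriented_cycle D C \<longleftrightarrow> (\<exists>vs es. cycle_labelling D vs es \<and> C = set es)"

definition oriented_path :: "('v, 'e) wo_graph \<Rightarrow> 'v list \<Rightarrow> 'e list \<Rightarrow> bool" where
  "oriented_path D vs es \<longleftrightarrow>
     length vs = Suc (length es) \<and> distinct vs \<and>
     (\<forall>i < length es. ends D (es ! i) = {vs ! i, vs ! Suc i})"

text \<open>
  Rotating the labelling permutes the factors of the two products and reversing it exchanges the
  products, so the choice of the labelling of \<open>C\<close> does not matter.
\<close>

definition balanced :: "('v, 'e) wo_graph \<Rightarrow> 'e set \<Rightarrow> bool" where
  "balanced D C \<longleftrightarrow>
     (\<exists>vs es. cycle_labelling D vs es \<and> C = set es \<and>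
        (let n = length vs; a = (\<lambda>i j. incidence D (vs ! i) (es ! j)) in
           even n \<and> (\<Prod>i<n. a i i) = a 0 (n - 1) * (\<Prod>i<n - 1. a (Suc i) i)))"


section \<open>The three shapes of a union of two cycles\<close>

definition share_vertex :: "('v, 'e) wo_graph \<Rightarrow> 'e set \<Rightarrow> 'e set \<Rightarrow> bool" where
  "share_vertex D C C' \<longleftrightarrow>
     C \<inter> C' = {} \<and> (\<exists>x. verts D C \<inter> verts D C' = {x}) \<and>
     C \<union> C' = UNIV \<and> verts D C \<union> verts D C' = UNIV"

definition share_path :: "('v, 'e) wo_graph \<Rightarrow> 'e set \<Rightarrow> 'e set \<Rightarrow> bool" where
  "share_path D C C' \<longleftrightarrow>
     (\<exists>vs es. oriented_path D vs es \<and> length es \<ge> 1 \<and>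
        C \<inter> C' = set es \<and> verts D C \<inter> verts D C' = set vs) \<and>
     C \<union> C' = UNIV \<and> verts D C \<union> verts D C' = UNIV"

definition connected_by_path :: "('v, 'e) wo_graph \<Rightarrow> 'e set \<Rightarrow> 'e set \<Rightarrow> bool" where
  "connected_by_path D C C' \<longleftrightarrow>
     verts D C \<inter> verts D C' = {} \<and>
     (\<exists>vs es. oriented_path D vs es \<and> length es \<ge> 1 \<and>
        verts D C \<inter> set vs = {hd vs} \<and> verts D C' \<inter> set vs = {last vs} \<and>
        C \<union> C' \<union> set es = UNIV \<and> verts D C \<union> verts D C' \<union> set vs = UNIV)"


section \<open>Polynomials and the toric ideal\<close>

text \<open>
  A polynomial in the variables \<open>'x\<close> maps exponent vectors to coefficients; its multiplication is
  the convolution product of \<^theory>\<open>HOL-Library.Poly_Mapping\<close>.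
\<close>

type_synonym ('x, 'k) mpoly = "('x \<Rightarrow>\<^sub>0 nat) \<Rightarrow>\<^sub>0 'k"

definition Const :: "'k::zero \<Rightarrow> ('x, 'k) mpoly" where
  "Const c = Poly_Mapping.single 0 c"

definition Var :: "'x \<Rightarrow> ('x, 'k::zero_neq_one) mpoly" where
  "Var x = Poly_Mapping.single (Poly_Mapping.single x 1) 1"

definition monomial :: "('x \<Rightarrow>\<^sub>0 nat) \<Rightarrow> ('x::finite, 'k::comm_ring_1) mpoly" where
  "monomial r = (\<Prod>x\<in>UNIV. Var x ^ Poly_Mapping.lookup r x)"

text \<open>The \<open>k\<close>-algebra homomorphism that sends each variable \<open>x\<close> to \<open>g x\<close>.\<close>

definition alg_hom ::
    "('x \<Rightarrow> ('y, 'k) mpoly) \<Rightarrow> ('x::finite, 'k::comm_ring_1) mpoly \<Rightarrow> ('y, 'k) mpoly" where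
  "alg_hom g p =
     (\<Sum>m\<in>Poly_Mapping.keys p. Const (Poly_Mapping.lookup p m) *
        (\<Prod>x\<in>UNIV. g x ^ Poly_Mapping.lookup m x))"

definition toric_ideal ::
    "('v::finite, 'e::finite) wo_graph \<Rightarrow> ('e, 'k::field) mpoly set" where
  "toric_ideal D =
     {p. alg_hom (\<lambda>e. Var (tail D e) * Var (head D e) ^ weight D (head D e)) p = 0}"

text \<open>An ideal of a commutative ring is a submodule of the ring over itself.\<close>

definition ideal_generated :: "'a::comm_ring_1 set \<Rightarrow> 'a set" where
  "ideal_generated S = module.span (*) S"

definition is_binomial :: "('x::finite, 'k::comm_ring_1) mpoly \<Rightarrow> bool" where
  "is_binomial f \<longleftrightarrow>
     (\<exists>r s. (\<forall>x. Poly_Mapping.lookup r x = 0 \<or> Poly_Mapping.lookup s x = 0) \<and>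
        f = monomial r - monomial s)"

definition supp :: "('x, 'k::zero) mpoly \<Rightarrow> 'x set" where
  "supp f = (\<Union>m\<in>Poly_Mapping.keys f. Poly_Mapping.keys m)"

end

theory Submission
  imports Defs "HOL-Library.Cardinality"
begin

text \<open>
  Write \<open>f = e\<^sup>r - e\<^sup>s\<close>; then \<open>u = r - s\<close> is a nonzero integer vector in the kernel of the incidence
  matrix.  A balanced cycle \<open>C\<close> carries a kernel vector \<open>z\<close> with support \<open>C\<close>, and since the binomial
  of \<open>z\<close> is a multiple of \<open>f\<close>, \<open>z\<close> is an integer multiple of \<open>u\<close>; hence \<open>supp f = C\<close>.

  Conversely, the support \<open>S\<close> of a kernel vector has no vertex of degree one.  In all three shapes \<open>D\<close> is
  connected, has minimum degree at least two and at most one edge more than vertices, which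
  forces a support \<open>S\<close> other than all of \<open>D\<close> to be 2-regular.  A cycle contained in such an \<open>S\<close> is a
  component of it, so \<open>u\<close> restricts to a kernel vector on it, and multiplying the relations at
  its vertices shows that it is balanced.
\<close>

section \<open>Binomials and the kernel of the incidence matrix\<close>

lemma Var_power: "Var x ^ n = Poly_Mapping.single (Poly_Mapping.single x n) (1::'k::comm_ring_1)"
  by (induction n) (simp_all add: Var_def mult_single single_add[symmetric] add.commute)

lemma prod_single_one:
  "finite A \<Longrightarrow> (\<Prod>x\<in>A. Poly_Mapping.single (h x) (1::'k::comm_ring_1)) = Poly_Mapping.single (\<Sum>x\<in>A. h x) 1"
  by (induction A rule: finite_induct) (simp_all add: mult_single)

lemma monomial_eq_single: "monomial r = Poly_Mapping.single r (1::'k::comm_ring_1)"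
proof -
  have "(\<Sum>x\<in>UNIV. Poly_Mapping.single x (Poly_Mapping.lookup r x)) = r"
    by (rule poly_mapping_eqI) (simp add: lookup_sum lookup_single when_def)
  then show ?thesis
    unfolding monomial_def by (simp add: Var_power prod_single_one)
qed

lemma keys_binomial:
  assumes "r \<noteq> s"
  shows "Poly_Mapping.keys (monomial r - monomial s :: ('x::finite, 'k::field) mpoly) = {r, s}"
  using assms
  by (auto simp: in_keys_iff monomial_eq_single lookup_minus lookup_single when_def split: if_splits)

text \<open>As the ends of \<open>e\<close> differ, no exponent is lost to the order of the cases in
  \<open>incidence\<close>: the exponent vector of the image is \<open>n\<close> times the column of
  \<open>e\<close> in the incidence matrix.\<close>

lemma edge_image_power:
  fixes D :: "('v::finite, 'e::finite) wo_graph"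
  assumes "tail D e \<noteq> head D e"
  shows "(Var (tail D e) * Var (head D e) ^ weight D (head D e)) ^ n =
    Poly_Mapping.single (Abs_poly_mapping (\<lambda>v. incidence D v e * n)) (1::'k::comm_ring_1)"
proof -
  have "Abs_poly_mapping (\<lambda>v. incidence D v e * n) =
    Poly_Mapping.single (tail D e) n + Poly_Mapping.single (head D e) (weight D (head D e) * n)"
    by (rule poly_mapping_eqI)
      (use assms in \<open>auto simp: lookup_add lookup_single when_def incidence_def\<close>)
  moreover have "(Var (tail D e) * Var (head D e) ^ weight D (head D e)) ^ n =
      Var (tail D e) ^ n * (Var (head D e) ^ (weight D (head D e) * n) :: ('v, 'k) mpoly)"
    by (simp only: power_mult_distrib power_mult)
  ultimately show ?thesis
    by (simp only: Var_power mult_single mult_1)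
qed

text \<open>The homomorphism sends a monomial to a monomial, and acts on exponent vectors by the
  incidence matrix. The images of the two terms therefore cancel exactly when their exponent vectors
  agree.\<close>

lemma binomial_in_toric_ideal:
  fixes D :: "('v::finite, 'e::finite) wo_graph"
  assumes "weighted_oriented_graph D"
  shows "(monomial r - monomial s :: ('e, 'k::field) mpoly) \<in> toric_ideal D \<longleftrightarrow>
    (\<forall>v. (\<Sum>e\<in>UNIV. incidence D v e * Poly_Mapping.lookup r e) =
         (\<Sum>e\<in>UNIV. incidence D v e * Poly_Mapping.lookup s e))"
proof (cases "r = s")
  case True
  then show ?thesis by (simp add: toric_ideal_def alg_hom_def)
next
  case False
  let ?A = "\<lambda>m e. Abs_poly_mapping (\<lambda>v. incidence D v e * Poly_Mapping.lookup m e)"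
  have img: "(\<Prod>e\<in>UNIV. (Var (tail D e) * Var (head D e) ^ weight D (head D e)) ^ Poly_Mapping.lookup m e) =
      Poly_Mapping.single (\<Sum>e\<in>UNIV. ?A m e) (1::'k)" for m
    using assms by (simp add: edge_image_power weighted_oriented_graph_def prod_single_one)
  have "alg_hom (\<lambda>e. Var (tail D e) * Var (head D e) ^ weight D (head D e))
      (monomial r - monomial s :: ('e, 'k) mpoly) =
      Poly_Mapping.single (\<Sum>e\<in>UNIV. ?A r e) 1 - Poly_Mapping.single (\<Sum>e\<in>UNIV. ?A s e) 1"
    unfolding alg_hom_def keys_binomial[OF False] img using False
    by (simp add: Const_def mult_single monomial_eq_single lookup_minus lookup_single when_def single_uminus)
  moreover have "Poly_Mapping.single a (1::'k) - Poly_Mapping.single b 1 = 0 \<longleftrightarrow> a = b" for a b :: "'v \<Rightarrow>\<^sub>0 nat"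
    by (metis diff_eq_eq add_0 inj_single keys_single one_neq_zero singleton_inject)
  ultimately have "(monomial r - monomial s :: ('e, 'k) mpoly) \<in> toric_ideal D \<longleftrightarrow>
      (\<Sum>e\<in>UNIV. ?A r e) = (\<Sum>e\<in>UNIV. ?A s e)"
    by (simp add: toric_ideal_def)
  also have "\<dots> \<longleftrightarrow> (\<forall>v. (\<Sum>e\<in>UNIV. incidence D v e * Poly_Mapping.lookup r e) =
         (\<Sum>e\<in>UNIV. incidence D v e * Poly_Mapping.lookup s e))"
    by (simp add: poly_mapping_eq_iff fun_eq_iff lookup_sum)
  finally show ?thesis .
qed

definition exponent_diff :: "('x \<Rightarrow>\<^sub>0 nat) \<Rightarrow> ('x \<Rightarrow>\<^sub>0 nat) \<Rightarrow> 'x \<Rightarrow> int" where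
  "exponent_diff r s x = int (Poly_Mapping.lookup r x) - int (Poly_Mapping.lookup s x)"

definition kernel_vector :: "('v, 'e::finite) wo_graph \<Rightarrow> ('e \<Rightarrow> int) \<Rightarrow> bool" where
  "kernel_vector D u \<longleftrightarrow> (\<forall>v. (\<Sum>e\<in>UNIV. int (incidence D v e) * u e) = 0)"

lemma binomial_in_toric_ideal_iff_kernel_vector:
  fixes D :: "('v::finite, 'e::finite) wo_graph"
  assumes "weighted_oriented_graph D"
  shows "(monomial r - monomial s :: ('e, 'k::field) mpoly) \<in> toric_ideal D \<longleftrightarrow>
    kernel_vector D (exponent_diff r s)"
proof -
  have "(\<Sum>e\<in>UNIV. int (incidence D v e) * exponent_diff r s e) =
      int (\<Sum>e\<in>UNIV. incidence D v e * Poly_Mapping.lookup r e) -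
      int (\<Sum>e\<in>UNIV. incidence D v e * Poly_Mapping.lookup s e)" for v
    by (simp add: exponent_diff_def right_diff_distrib sum_subtractf)
  then show ?thesis
    unfolding binomial_in_toric_ideal[OF assms] kernel_vector_def
    by (simp only: right_minus_eq of_nat_eq_iff)
qed

text \<open>Since no variable occurs in both terms, subtracting the exponents cancels none of
  them.\<close>

lemma supp_binomial:
  assumes "\<And>x. Poly_Mapping.lookup r x = 0 \<or> Poly_Mapping.lookup s x = 0" and "r \<noteq> s"
  shows "supp (monomial r - monomial s :: ('x::finite, 'k::field) mpoly) = {x. exponent_diff r s x \<noteq> 0}"
  using assms(1)
  unfolding supp_def keys_binomial[OF assms(2)] exponent_diff_def
  by (auto simp: in_keys_iff) (metis neq0_conv)+

text \<open>
  The functional \<open>\<phi>\<close> in the proof adds up the coefficients of the monomials in one class modulo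
  \<open>\<int>(r - s)\<close>; it vanishes on all multiples of the binomial with exponents \<open>r\<close> and \<open>s\<close>.
\<close>

lemma exponent_diff_in_principal_ideal:
  fixes r s a b :: "'x::finite \<Rightarrow>\<^sub>0 nat"
  assumes "(monomial a - monomial b :: ('x, 'k::field) mpoly) \<in> ideal_generated {monomial r - monomial s}"
  shows "\<exists>k. \<forall>x. exponent_diff a b x = k * exponent_diff r s x"
proof (rule ccontr)
  assume no: "\<not> ?thesis"
  define R where "R m \<longleftrightarrow> (\<exists>k. \<forall>x. exponent_diff a m x = k * exponent_diff r s x)" for m
  define \<phi> :: "('x, 'k) mpoly \<Rightarrow> 'k"
    where "\<phi> p = (\<Sum>m\<in>Poly_Mapping.keys p. if R m then Poly_Mapping.lookup p m else 0)" for p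
  \<comment> \<open>Cancellation can make the keys of a sum smaller than the union of the keys, so
    additivity is checked over a common finite superset.\<close>
  have sub: "\<phi> p = (\<Sum>m\<in>A. if R m then Poly_Mapping.lookup p m else 0)"
    if "finite A" "Poly_Mapping.keys p \<subseteq> A" for A p
    unfolding \<phi>_def using that by (intro sum.mono_neutral_left) (auto simp: in_keys_iff)
  have add: "\<phi> (p + q) = \<phi> p + \<phi> q" for p q
  proof -
    let ?A = "Poly_Mapping.keys p \<union> Poly_Mapping.keys q"
    have "finite ?A" "Poly_Mapping.keys p \<subseteq> ?A" "Poly_Mapping.keys q \<subseteq> ?A"
      "Poly_Mapping.keys (p + q) \<subseteq> ?A"
      using keys_add[of p q] by auto
    then show ?thesis
      by (simp add: sub[of ?A] sum.distrib[symmetric] lookup_add if_distrib cong: if_cong)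
  qed
  have single: "\<phi> (Poly_Mapping.single m c) = (if R m then c else 0)" for m c
    by (simp add: \<phi>_def)
  \<comment> \<open>The two exponent vectors differ by \<open>r - s\<close> and so lie in the same
    class.\<close>
  have shift: "R (t + r) \<longleftrightarrow> R (t + s)" for t
  proof -
    have "exponent_diff a (t + s) x = exponent_diff a (t + r) x + exponent_diff r s x" for x
      by (simp add: exponent_diff_def lookup_add)
    then have "(\<forall>x. exponent_diff a (t + r) x = k * exponent_diff r s x) \<longleftrightarrow>
        (\<forall>x. exponent_diff a (t + s) x = (k + 1) * exponent_diff r s x)" for k
      by (simp add: algebra_simps)
    then show ?thesis
      unfolding R_def by (metis diff_add_cancel)
  qed
  have diff: "\<phi> (p - q) = \<phi> p - \<phi> q" for p q
    using add[of "p - q" q] by simp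
  have "\<phi> (q * monomial r) = \<phi> (q * monomial s)" for q
  proof -
    have zero: "\<phi> 0 = 0" by (simp add: \<phi>_def)
    have sum: "finite A \<Longrightarrow> \<phi> (\<Sum>m\<in>A. g m) = (\<Sum>m\<in>A. \<phi> (g m))" for A and g :: "_ \<Rightarrow> ('x, 'k) mpoly"
      by (induction A rule: finite_induct) (simp_all add: add zero)
    have q: "q = (\<Sum>m\<in>Poly_Mapping.keys q. Poly_Mapping.single m (Poly_Mapping.lookup q m))"
      by (rule poly_mapping_eqI) (simp add: lookup_sum lookup_single when_def in_keys_iff)
    show ?thesis
      by (subst (1 2) q) (simp add: sum_distrib_right sum monomial_eq_single mult_single single shift)
  qed
  then have van: "\<phi> (q * (monomial r - monomial s)) = 0" for q
    by (simp add: right_diff_distrib diff)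
  interpret module "(*) :: ('x, 'k) mpoly \<Rightarrow> _"
    by standard (simp_all add: algebra_simps)
  have "(monomial a - monomial b :: ('x, 'k) mpoly) \<in> range (\<lambda>q. q * (monomial r - monomial s))"
    using assms by (simp add: ideal_generated_def span_singleton)
  then have "\<phi> (monomial a - monomial b) = 0"
    using van by auto
  \<comment> \<open>The class is that of \<open>a\<close>, and \<open>b\<close> lies outside it by
    assumption, so \<open>\<phi>\<close> takes the value 1 on the binomial of \<open>a\<close> and
    \<open>b\<close>.\<close>
  moreover have "R a"
    unfolding R_def by (rule exI[of _ 0]) (simp add: exponent_diff_def)
  moreover have "\<not> R b"
    using no by (simp add: R_def)
  ultimately show False
    by (simp add: diff monomial_eq_single single)
qed

section \<open>Incidence along a cycle\<close>

lemma incidence_eq_0_iff: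
  assumes "weighted_oriented_graph D"
  shows "incidence D v e = 0 \<longleftrightarrow> v \<notin> ends D e"
  using assms by (auto simp: weighted_oriented_graph_def incidence_def ends_def)

lemma card_ends:
  assumes "weighted_oriented_graph D"
  shows "card (ends D e) = 2"
  using assms by (simp add: weighted_oriented_graph_def ends_def)

abbreviation star :: "('v, 'e) wo_graph \<Rightarrow> 'e set \<Rightarrow> 'v \<Rightarrow> 'e set" where
  "star D F v \<equiv> {e \<in> F. v \<in> ends D e}"

text \<open>The cyclic predecessor; replacing 0 by \<open>n\<close> first avoids truncated
  subtraction.\<close>

abbreviation prev :: "nat \<Rightarrow> nat \<Rightarrow> nat" where
  "prev n i \<equiv> (if i = 0 then n else i) - 1"

lemma Suc_mod_eq: "j < n \<Longrightarrow> Suc j mod n = (if Suc j = n then 0 else Suc j)"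
  by auto

lemma cycle_labellingD:
  assumes "cycle_labelling D vs es"
  shows "length vs \<ge> 3" "length es = length vs" "distinct vs"
    "\<And>i. i < length vs \<Longrightarrow> ends D (es ! i) = {vs ! i, vs ! (Suc i mod length vs)}"
  using assms unfolding cycle_labelling_def by blast+

lemma cycle_labelling_Suc_mod_less:
  assumes "cycle_labelling D vs es"
  shows "Suc i mod length vs < length vs"
proof (rule mod_less_divisor)
  show "0 < length vs" using cycle_labellingD(1)[OF assms] by linarith
qed

text \<open>An edge occurring at two positions would make each position the cyclic successor of the
  other, which is impossible for length at least 3.\<close>

lemma cycle_labelling_distinct_edges:
  assumes "cycle_labelling D vs es"
  shows "distinct es"
proof (unfold distinct_conv_nth, intro allI impI)
  fix i j assume ij: "i < length es" "j < length es" "i \<noteq> j"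
  let ?n = "length vs"
  have n: "?n \<ge> 3" "length es = ?n" "distinct vs"
    and e: "\<And>i. i < ?n \<Longrightarrow> ends D (es ! i) = {vs ! i, vs ! (Suc i mod ?n)}"
    using cycle_labellingD[OF assms(1)] by blast+
  show "es ! i \<noteq> es ! j"
  proof
    assume "es ! i = es ! j"
    then have "{vs ! i, vs ! (Suc i mod ?n)} = {vs ! j, vs ! (Suc j mod ?n)}"
      using ij n e by metis
    moreover have "vs ! i \<noteq> vs ! j"
      using ij n by (simp add: nth_eq_iff_index_eq)
    ultimately have "vs ! i = vs ! (Suc j mod ?n)" "vs ! j = vs ! (Suc i mod ?n)"
      by (auto simp: doubleton_eq_iff)
    moreover have "Suc i mod ?n < ?n" "Suc j mod ?n < ?n"
      by (rule cycle_labelling_Suc_mod_less[OF assms])+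
    ultimately have "i = Suc j mod ?n" "j = Suc i mod ?n"
      using ij n(2,3) by (simp_all only: nth_eq_iff_index_eq)
    then show False
      using ij n by (auto simp: Suc_mod_eq split: if_splits)
  qed
qed

text \<open>This reduces a sum over the cycle edges at a vertex to two distinct terms.\<close>

lemma cycle_star:
  assumes "cycle_labelling D vs es" and i: "i < length vs"
  shows "star D (set es) (vs ! i) = {es ! i, es ! prev (length vs) i}"
    and "es ! i \<noteq> es ! prev (length vs) i"
proof -
  let ?n = "length vs"
  have n: "?n \<ge> 3" "length es = ?n" "distinct vs"
    and e: "\<And>i. i < ?n \<Longrightarrow> ends D (es ! i) = {vs ! i, vs ! (Suc i mod ?n)}"
    using cycle_labellingD[OF assms(1)] by blast+
  have mem: "vs ! i \<in> ends D (es ! j) \<longleftrightarrow> j = i \<or> j = prev ?n i" if "j < ?n" for j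
  proof -
    have "Suc j mod ?n < ?n" by (rule cycle_labelling_Suc_mod_less[OF assms(1)])
    then have "vs ! i \<in> ends D (es ! j) \<longleftrightarrow> i = j \<or> i = Suc j mod ?n"
      using that i n(3) by (simp add: e nth_eq_iff_index_eq)
    also have "i = Suc j mod ?n \<longleftrightarrow> j = prev ?n i"
      using that i by (auto simp: Suc_mod_eq)
    finally show ?thesis by auto
  qed
  have p: "prev ?n i < ?n" using i by auto
  show "star D (set es) (vs ! i) = {es ! i, es ! prev ?n i}"
  proof (intro equalityI subsetI)
    fix x assume "x \<in> star D (set es) (vs ! i)"
    then obtain j where "j < ?n" "x = es ! j" "vs ! i \<in> ends D (es ! j)"
      using n(2) by (auto simp: in_set_conv_nth)
    then show "x \<in> {es ! i, es ! prev ?n i}"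
      using mem by blast
  next
    fix x assume "x \<in> {es ! i, es ! prev ?n i}"
    then show "x \<in> star D (set es) (vs ! i)"
      using mem[OF i] mem[OF p] i p n(2) by (metis (no_types, lifting) insertE mem_Collect_eq nth_mem singletonD)
  qed
  have "prev ?n i \<noteq> i" using i n(1) by auto
  then show "es ! i \<noteq> es ! prev ?n i"
    using cycle_labelling_distinct_edges[OF assms(1)] i p n(2) by (simp only: nth_eq_iff_index_eq)
qed

lemma cycle_labelling_verts:
  assumes "cycle_labelling D vs es"
  shows "verts D (set es) = set vs"
proof -
  note c = cycle_labellingD[OF assms]
  have "verts D (set es) = (\<Union>i<length vs. {vs ! i, vs ! (Suc i mod length vs)})"
    using c(2,4) by (auto simp: verts_def set_conv_nth)
  also have "\<dots> = set vs"
    using cycle_labelling_Suc_mod_less[OF assms] by (auto simp: set_conv_nth)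
  finally show ?thesis .
qed

lemma oriented_cycle_degree:
  assumes "oriented_cycle D C" and "v \<in> verts D C"
  shows "card (star D C v) = 2"
proof -
  obtain vs es where c: "cycle_labelling D vs es" and C: "C = set es"
    using assms(1) by (auto simp: oriented_cycle_def)
  obtain i where "i < length vs" "v = vs ! i"
    using assms(2) by (auto simp: C cycle_labelling_verts[OF c] in_set_conv_nth)
  then show ?thesis
    using cycle_star[OF c] by (simp only: C card_2_iff) blast
qed

lemma oriented_cycle_card_verts:
  assumes "oriented_cycle D C"
  shows "card (verts D C) = card C"
proof -
  obtain vs es where c: "cycle_labelling D vs es" and C: "C = set es"
    using assms(1) by (auto simp: oriented_cycle_def)
  have "distinct vs" "length vs = length es"
    using c by (auto simp: cycle_labelling_def)
  then show ?thesis
    by (simp add: C cycle_labelling_verts[OF c] distinct_card cycle_labelling_distinct_edges[OF c])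
qed

lemma oriented_cycle_nonempty: "oriented_cycle D C \<Longrightarrow> C \<noteq> {}"
  by (auto simp: oriented_cycle_def cycle_labelling_def)

section \<open>Kernel vectors and balanced cycles\<close>

text \<open>The two-term relations make the values of \<open>u\<close> alternate in sign around the
  cycle, so its length is even. Multiplying all relations and cancelling the nonzero product of the
  values of \<open>u\<close> leaves the equality of the two incidence products.\<close>

lemma balanced_if_relations:
  fixes D :: "('v::finite, 'e::finite) wo_graph" and u :: "'e \<Rightarrow> int"
  assumes D: "weighted_oriented_graph D" and c: "cycle_labelling D vs es"
    and nz: "\<And>e. e \<in> set es \<Longrightarrow> u e \<noteq> 0"
    and rel: "\<And>i. i < length vs \<Longrightarrow> int (incidence D (vs ! i) (es ! i)) * u (es ! i) +
      int (incidence D (vs ! i) (es ! prev (length vs) i)) * u (es ! prev (length vs) i) = 0"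
  shows "balanced D (set es)"
proof -
  define a where "a i j = incidence D (vs ! i) (es ! j)" for i j
  define t where "t i = u (es ! i)" for i
  obtain m where n: "length vs = Suc m" and len: "length es = Suc m"
    using c by (cases "length vs") (auto simp: cycle_labelling_def)
  have t: "t i \<noteq> 0" if "i \<le> m" for i
    using nz that len by (simp add: t_def)
  have pos: "a i i > 0" if "i \<le> m" for i
  proof -
    have "vs ! i \<in> ends D (es ! i)"
      using c that n by (simp add: cycle_labelling_def)
    then show ?thesis
      using incidence_eq_0_iff[OF D] by (metis a_def gr0I)
  qed
  have step: "int (a (Suc i) (Suc i)) * t (Suc i) = - (int (a (Suc i) i) * t i)" if "i < m" for i
    using rel[of "Suc i"] that n by (simp add: a_def t_def)
  have start: "int (a 0 0) * t 0 = - (int (a 0 m) * t m)"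
    using rel[of 0] n by (simp add: a_def t_def)
  \<comment> \<open>The coefficient \<open>q\<close> cannot vanish, because the left-hand side is
    nonzero.\<close>
  have flip: "sgn x = - sgn y" if "int p * x = - (int q * y)" "p > 0" "x \<noteq> 0" for p q and x y :: int
  proof -
    have "q \<noteq> 0" using that by (intro notI) simp
    have "sgn (int p * x) = sgn (- (int q * y))"
      using that(1) by (rule arg_cong)
    then show ?thesis
      using \<open>q \<noteq> 0\<close> that(2)
      by (simp only: sgn_mult sgn_minus of_nat_0_less_iff sgn_pos mult_1 mult_minus_right gr0I)
  qed
  have alt: "sgn (t i) = (-1) ^ i * sgn (t 0)" if "i \<le> m" for i
    using that
  proof (induction i)
    case 0
    show ?case by (simp only: power_0 mult_1)
  next
    case (Suc i)
    have "sgn (t (Suc i)) = - sgn (t i)"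
      using Suc.prems by (intro flip[OF step] pos t) simp_all
    also have "sgn (t i) = (-1) ^ i * sgn (t 0)" using Suc by simp
    finally show ?case by simp
  qed
  \<comment> \<open>Here \<open>m\<close> is the length minus one. The relation at vertex 0 flips
    the sign once more, which contradicts \<open>alt\<close> if \<open>m\<close> is even.\<close>
  have odd: "odd m"
  proof
    assume "even m"
    then have "sgn (t m) = sgn (t 0)" using alt[of m] by (simp only: order_refl neg_one_even_power mult_1)
    moreover have "sgn (t 0) = - sgn (t m)"
      by (intro flip[OF start] pos t) simp_all
    ultimately have "sgn (t 0) = 0" by linarith
    then show False using t[of 0] by (simp add: sgn_0_0)
  qed
  \<comment> \<open>The product of all relations has one minus sign per vertex, and their number
    \<open>Suc m\<close> is even.\<close>
  have "(\<Prod>i<Suc m. int (a i i) * t i) = (\<Prod>i<m. - (int (a (Suc i) i) * t i)) * - (int (a 0 m) * t m)"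
    by (simp only: prod.lessThan_Suc_shift start) (simp add: step)
  also have "\<dots> = (-1) ^ Suc m * ((\<Prod>i<m. int (a (Suc i) i)) * int (a 0 m) * (\<Prod>i<Suc m. t i))"
    by (simp add: prod_uminus prod.distrib)
  finally have "(\<Prod>i<Suc m. int (a i i)) * (\<Prod>i<Suc m. t i) =
      (int (a 0 m) * (\<Prod>i<m. int (a (Suc i) i))) * (\<Prod>i<Suc m. t i)"
    using odd by (simp only: prod.distrib) (simp add: mult_ac)
  moreover have "(\<Prod>i<Suc m. t i) \<noteq> 0"
    using t by (simp only: prod_zero_iff finite_lessThan) (auto simp: less_Suc_eq_le)
  ultimately have "(\<Prod>i<Suc m. int (a i i)) = int (a 0 m) * (\<Prod>i<m. int (a (Suc i) i))"
    by (rule mult_right_cancel[THEN iffD1, rotated])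
  then have "int (\<Prod>i<Suc m. a i i) = int (a 0 m * (\<Prod>i<m. a (Suc i) i))"
    by (simp only: of_nat_prod of_nat_mult)
  then have "(\<Prod>i<Suc m. a i i) = a 0 m * (\<Prod>i<m. a (Suc i) i)"
    by (simp only: of_nat_eq_iff)
  then show ?thesis
    unfolding balanced_def using c n odd by (intro exI[of _ vs] exI[of _ es]) (simp add: Let_def a_def)
qed

lemma kernel_vector_sum_star:
  fixes D :: "('v::finite, 'e::finite) wo_graph"
  assumes D: "weighted_oriented_graph D"
    and S: "\<And>e. e \<notin> S \<Longrightarrow> u e = 0"
  shows "(\<Sum>e\<in>UNIV. int (incidence D v e) * u e) = (\<Sum>e\<in>star D S v. int (incidence D v e) * u e)"
proof (rule sum.mono_neutral_right)
  show "\<forall>e\<in>UNIV - star D S v. int (incidence D v e) * u e = 0"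
  proof
    fix e assume "e \<in> UNIV - star D S v"
    then have "incidence D v e = 0 \<or> u e = 0"
      using S[of e] incidence_eq_0_iff[OF D, of v e] by blast
    then show "int (incidence D v e) * u e = 0" by auto
  qed
qed simp_all

text \<open>A cycle vertex already has two cycle edges in the support of \<open>u\<close>, which is
  2-regular. The kernel equation there thus has only these two terms, as
  \<open>balanced_if_relations\<close> demands.\<close>

lemma balanced_if_kernel_vector:
  fixes D :: "('v::finite, 'e::finite) wo_graph"
  assumes D: "weighted_oriented_graph D" and u: "kernel_vector D u"
    and c: "cycle_labelling D vs es" and sub: "set es \<subseteq> {e. u e \<noteq> 0}"
    and reg: "\<And>v. v \<in> verts D {e. u e \<noteq> 0} \<Longrightarrow> card (star D {e. u e \<noteq> 0} v) = 2"
  shows "balanced D (set es)"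
proof (rule balanced_if_relations[OF D c])
  show "u e \<noteq> 0" if "e \<in> set es" for e using that sub by auto
next
  fix i assume i: "i < length vs"
  define S where "S = {e. u e \<noteq> 0}"
  define v where "v = vs ! i"
  define e where "e = es ! i"
  define f where "f = es ! prev (length vs) i"
  have ef: "star D (set es) v = {e, f}" "e \<noteq> f"
    unfolding v_def e_def f_def using cycle_star[OF c i] by blast+
  have "v \<in> verts D (set es)"
    using cycle_labelling_verts[OF c] i by (simp add: v_def)
  then have "v \<in> verts D S"
    using sub by (auto simp: verts_def S_def)
  then have "card (star D S v) = card {e, f}"
    using reg[folded S_def] ef(2) by simp
  moreover have "{e, f} \<subseteq> star D S v" using sub ef(1) by (auto simp: S_def)
  ultimately have "star D S v = {e, f}"
    by (intro card_subset_eq[symmetric]) simp_all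
  moreover have "(\<Sum>e\<in>UNIV. int (incidence D v e) * u e) =
      (\<Sum>e\<in>star D S v. int (incidence D v e) * u e)"
    by (rule kernel_vector_sum_star[OF D]) (simp add: S_def)
  ultimately have "0 = (\<Sum>e\<in>{e, f}. int (incidence D v e) * u e)"
    using u by (simp only: kernel_vector_def)
  then show "int (incidence D (vs ! i) (es ! i)) * u (es ! i) +
      int (incidence D (vs ! i) (es ! prev (length vs) i)) * u (es ! prev (length vs) i) = 0"
    unfolding v_def[symmetric] e_def[symmetric] f_def[symmetric] using ef(2) by simp
qed

text \<open>The two-term relations can be solved one after another around the cycle; balance is the
  condition that the last value fits the first.\<close>

lemma kernel_vector_if_balanced:
  fixes D :: "('v::finite, 'e::finite) wo_graph"
  assumes D: "weighted_oriented_graph D" and "balanced D C"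
  obtains z where "kernel_vector D z" "{e. z e \<noteq> 0} = C"
proof -
  obtain vs es where c: "cycle_labelling D vs es" and C: "C = set es"
    and ev: "even (length vs)"
    and bal: "(\<Prod>i<length vs. incidence D (vs ! i) (es ! i)) =
      incidence D (vs ! 0) (es ! (length vs - 1)) *
      (\<Prod>i<length vs - 1. incidence D (vs ! Suc i) (es ! i))"
    using assms(2) by (auto simp: balanced_def Let_def)
  define a where "a i j = int (incidence D (vs ! i) (es ! j))" for i j
  obtain m where n: "length vs = Suc m" and len: "length es = Suc m"
    using c by (cases "length vs") (auto simp: cycle_labelling_def)
  have dist: "distinct es" using c by (rule cycle_labelling_distinct_edges)
  \<comment> \<open>\<open>t\<^sub>0 = 1\<close> and \<open>t\<^sub>i a\<^sub>i\<^sub>i = - t\<^sub>i\<^sub>-\<^sub>1 a\<^sub>i\<^sub>,\<^sub>i\<^sub>-\<^sub>1\<close>, with denominators cleared\<close>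
  define t where "t i = (-1) ^ i * (\<Prod>j<i. a (Suc j) j) * (\<Prod>j\<in>{i<..m}. a j j)" for i
  \<comment> \<open>The labelling has distinct edges, so the position of an edge is unique; off the
    cycle the vector is zero.\<close>
  define z where "z e = (if e \<in> set es then t (THE i. i < length es \<and> es ! i = e) else 0)" for e
  have z: "z (es ! i) = t i" if "i < length es" for i
  proof -
    have "(THE j. j < length es \<and> es ! j = es ! i) = i"
      using that dist by (intro the_equality) (auto simp: nth_eq_iff_index_eq)
    then show ?thesis using that by (simp add: z_def)
  qed
  have pos: "a i i \<noteq> 0" "a (Suc i mod Suc m) i \<noteq> 0" if "i \<le> m" for i
    using that c n incidence_eq_0_iff[OF D]
    by (auto simp: a_def cycle_labelling_def less_Suc_eq_le)
  have tnz: "t i \<noteq> 0" if "i \<le> m" for i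
  proof -
    have "a (Suc j) j \<noteq> 0" if "j < i" for j
      using pos(2)[of j] that \<open>i \<le> m\<close> by simp
    then show ?thesis using pos(1) by (simp add: t_def)
  qed
  have "{e. z e \<noteq> 0} = C"
  proof -
    have "z e \<noteq> 0 \<longleftrightarrow> e \<in> set es" for e
    proof (cases "e \<in> set es")
      case True
      then obtain i where "i < length es" "e = es ! i" by (auto simp: in_set_conv_nth)
      then show ?thesis using z tnz True len by auto
    qed (simp add: z_def)
    then show ?thesis by (simp add: C)
  qed
  moreover have "kernel_vector D z"
    unfolding kernel_vector_def
  proof
    fix v
    have s: "(\<Sum>e\<in>UNIV. int (incidence D v e) * z e) = (\<Sum>e\<in>star D (set es) v. int (incidence D v e) * z e)"
      by (rule kernel_vector_sum_star[OF D]) (simp add: z_def)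
    show "(\<Sum>e\<in>UNIV. int (incidence D v e) * z e) = 0"
    proof (cases "v \<in> set vs")
      case False
      then have "star D (set es) v = {}"
        using cycle_labelling_verts[OF c] by (auto simp: verts_def)
      then show ?thesis using s by (simp only: sum.empty)
    next
      case True
      then obtain i where i: "i < length vs" "v = vs ! i" by (auto simp: in_set_conv_nth)
      have "(\<Sum>e\<in>UNIV. int (incidence D v e) * z e) = a i i * t i + a i (prev (length vs) i) * t (prev (length vs) i)"
      proof -
        have "(\<Sum>e\<in>star D (set es) v. int (incidence D v e) * z e) =
            (\<Sum>e\<in>{es ! i, es ! prev (length vs) i}. int (incidence D v e) * z e)"
          by (simp only: i(2) cycle_star(1)[OF c i(1)])
        also have "\<dots> = a i i * z (es ! i) + a i (prev (length vs) i) * z (es ! prev (length vs) i)"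
          by (subst sum.insert) (use cycle_star(2)[OF c i(1)] in \<open>simp_all add: a_def i(2)\<close>)
        also have "z (es ! i) = t i" using z i n len by simp
        also have "z (es ! prev (length vs) i) = t (prev (length vs) i)" using z i n len by simp
        finally show ?thesis by (simp only: s)
      qed
      also have "\<dots> = 0"
      proof (cases i)
        case 0
        \<comment> \<open>At vertex 0 the cycle closes up: this is where balance enters, with even
          length supplying the sign.\<close>
        have "a 0 0 * (\<Prod>j\<in>{0<..m}. a j j) = (\<Prod>j<Suc m. a j j)"
          unfolding prod.lessThan_Suc_shift
          by (intro arg_cong2[of _ _ _ _ times] refl prod.reindex_bij_witness[of _ Suc "\<lambda>j. j - 1"]) auto
        also have "\<dots> = a 0 m * (\<Prod>j<m. a (Suc j) j)"
          using arg_cong[OF bal, of int] by (simp only: n of_nat_prod of_nat_mult a_def diff_Suc_1)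
        finally show ?thesis
          using 0 ev n by (simp add: t_def)
      next
        case (Suc k)
        \<comment> \<open>Consecutive values of \<open>t\<close> differ by a sign and by one factor
          in each product, so the relation cancels directly.\<close>
        then have "{k<..m} = insert (Suc k) {Suc k<..m}" using i n by auto
        then have "(\<Prod>j\<in>{k<..m}. a j j) = a i i * (\<Prod>j\<in>{i<..m}. a j j)" using Suc by simp
        then show ?thesis by (simp add: Suc t_def)
      qed
      finally show ?thesis .
    qed
  qed
  ultimately show thesis using that by blast
qed

section \<open>Connectedness and degrees\<close>

text \<open>These are the edge sets of unions of connected components, which allows connectedness to
  be stated without walks.\<close>

definition edge_closed :: "('v, 'e) wo_graph \<Rightarrow> 'e set \<Rightarrow> bool" where
  "edge_closed D S \<longleftrightarrow> (\<forall>e. ends D e \<inter> verts D S \<noteq> {} \<longrightarrow> e \<in> S)"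

lemma all_eq_if_Suc_eq:
  assumes "\<And>i. Suc i < n \<Longrightarrow> P i = P (Suc i)" and "i < n" "j < n"
  shows "P i = P j"
proof -
  have "P i = P 0" if "i < n" for i
    using that
  proof (induction i)
    case (Suc i)
    then show ?case using assms(1)[of i] by (simp only: Suc_lessD)
  qed (rule refl)
  from this[OF assms(2)] this[OF assms(3)] show ?thesis by (rule trans[OF _ sym])
qed

lemma edge_closedD:
  assumes "edge_closed D S" "v \<in> ends D e" "v \<in> verts D S"
  shows "e \<in> S" and "ends D e \<subseteq> verts D S"
proof -
  show "e \<in> S" using assms by (auto simp: edge_closed_def)
  then show "ends D e \<subseteq> verts D S" by (auto simp: verts_def)
qed

text \<open>Closedness passes membership in \<open>verts D S\<close> across an edge in both
  directions, so membership is constant along the walk.\<close>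

lemma edge_closed_walk:
  assumes S: "edge_closed D S" and n: "\<And>i. Suc i < length vs \<Longrightarrow> ends D (es ! i) = {vs ! i, vs ! Suc i}"
    and "v \<in> set vs" "v \<in> verts D S"
  shows "set vs \<subseteq> verts D S"
proof -
  have step: "vs ! i \<in> verts D S \<longleftrightarrow> vs ! Suc i \<in> verts D S" if "Suc i < length vs" for i
    using edge_closedD(2)[OF S, of _ "es ! i"] n[OF that] by auto
  obtain i where i: "i < length vs" "vs ! i \<in> verts D S"
    using assms(3,4) by (auto simp: in_set_conv_nth)
  have "vs ! j \<in> verts D S" if "j < length vs" for j
    using all_eq_if_Suc_eq[of "length vs" "\<lambda>i. vs ! i \<in> verts D S", OF step i(1) that] i(2) by simp
  then show ?thesis by (auto simp: in_set_conv_nth)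
qed

lemma edge_closed_cycle:
  assumes "oriented_cycle D C" and S: "edge_closed D S" and "verts D C \<inter> verts D S \<noteq> {}"
  shows "C \<subseteq> S"
proof -
  obtain vs es where c: "cycle_labelling D vs es" and C: "C = set es"
    using assms(1) by (auto simp: oriented_cycle_def)
  have "ends D (es ! i) = {vs ! i, vs ! Suc i}" if "Suc i < length vs" for i
    using cycle_labellingD(4)[OF c] that by simp
  moreover obtain v where "v \<in> set vs" "v \<in> verts D S"
    using assms(3) by (auto simp: C cycle_labelling_verts[OF c])
  ultimately have sub: "verts D C \<subseteq> verts D S"
    using edge_closed_walk[OF S, of vs es v] by (simp add: C cycle_labelling_verts[OF c])
  show ?thesis
  proof
    fix e assume "e \<in> C"
    then have "tail D e \<in> ends D e" "tail D e \<in> verts D S"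
      using sub by (auto simp: verts_def ends_def)
    then show "e \<in> S" by (rule edge_closedD(1)[OF S])
  qed
qed

lemma edge_closed_path:
  assumes p: "oriented_path D vs es" and S: "edge_closed D S" and v: "v \<in> set vs" "v \<in> verts D S"
  shows "set vs \<subseteq> verts D S" and "set es \<subseteq> S"
proof -
  show 1: "set vs \<subseteq> verts D S"
    by (rule edge_closed_walk[OF S _ v, of es]) (use p in \<open>auto simp: oriented_path_def\<close>)
  show "set es \<subseteq> S"
  proof
    fix e assume "e \<in> set es"
    then obtain i where "i < length es" "e = es ! i" by (auto simp: in_set_conv_nth)
    then have "vs ! i \<in> ends D e" "vs ! i \<in> set vs"
      using p by (auto simp: oriented_path_def)
    then show "e \<in> S" using 1 edge_closedD(1)[OF S] by blast
  qed
qed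

lemma oriented_path_distinct_edges:
  assumes "oriented_path D vs es"
  shows "distinct es"
proof (unfold distinct_conv_nth, intro allI impI notI)
  fix i j assume ij: "i < length es" "j < length es" "i \<noteq> j" and "es ! i = es ! j"
  have n: "length vs = Suc (length es)" "distinct vs"
    and ends: "\<And>i. i < length es \<Longrightarrow> ends D (es ! i) = {vs ! i, vs ! Suc i}"
    using assms by (simp_all add: oriented_path_def)
  have "{vs ! i, vs ! Suc i} = {vs ! j, vs ! Suc j}"
    using ends[OF ij(1)] ends[OF ij(2)] \<open>es ! i = es ! j\<close> by simp
  then show False
    using ij n by (auto simp: doubleton_eq_iff nth_eq_iff_index_eq)
qed

text \<open>The first clause is connectedness in terms of edges; the degree clause excludes isolated
  vertices.\<close>

definition bicyclic :: "('v::finite, 'e::finite) wo_graph \<Rightarrow> bool" where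
  "bicyclic D \<longleftrightarrow> (\<forall>S. S \<noteq> {} \<longrightarrow> edge_closed D S \<longrightarrow> S = UNIV) \<and>
     (\<forall>v. 2 \<le> card (star D UNIV v)) \<and> CARD('e) \<le> CARD('v) + 1"

section \<open>The three shapes are bicyclic\<close>

lemma verts_mono: "A \<subseteq> B \<Longrightarrow> verts D A \<subseteq> verts D B"
  by (auto simp: verts_def)

lemma edge_closed_meets:
  assumes "edge_closed D S" "S \<inter> F \<noteq> {}"
  shows "verts D F \<inter> verts D S \<noteq> {}"
  using assms(2) by (auto simp: verts_def ends_def)

lemma degree_ge_2_if_in_cycle:
  fixes D :: "('v::finite, 'e::finite) wo_graph"
  assumes "oriented_cycle D C" "v \<in> verts D C"
  shows "2 \<le> card (star D UNIV v)"
proof -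
  have "card (star D C v) \<le> card (star D UNIV v)" by (rule card_mono) auto
  then show ?thesis using oriented_cycle_degree[OF assms] by simp
qed

text \<open>A closed set that meets one cycle contains it, hence the shared vertex, hence the other
  cycle. The edge sets are disjoint while one vertex is counted twice, so there is one more edge
  than vertices.\<close>

lemma bicyclic_if_share_vertex:
  fixes D :: "('v::finite, 'e::finite) wo_graph"
  assumes C: "oriented_cycle D C" and C': "oriented_cycle D C'" and sh: "share_vertex D C C'"
  shows "bicyclic D"
proof -
  obtain x where x: "verts D C \<inter> verts D C' = {x}" and dis: "C \<inter> C' = {}"
    and un: "C \<union> C' = UNIV" "verts D C \<union> verts D C' = UNIV"
    using sh by (auto simp: share_vertex_def)
  have "S = UNIV" if S: "S \<noteq> {}" "edge_closed D S" for S
  proof -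
    have "S \<inter> C \<noteq> {} \<or> S \<inter> C' \<noteq> {}" using S un by blast
    then have "C \<subseteq> S \<or> C' \<subseteq> S"
      using edge_closed_cycle[OF C S(2)] edge_closed_cycle[OF C' S(2)] edge_closed_meets[OF S(2)] by blast
    then have "x \<in> verts D S" using x verts_mono by (metis Int_iff insertI1 subsetD)
    then show ?thesis
      using edge_closed_cycle[OF C S(2)] edge_closed_cycle[OF C' S(2)] x un by blast
  qed
  moreover have "2 \<le> card (star D UNIV v)" for v
    using degree_ge_2_if_in_cycle[OF C] degree_ge_2_if_in_cycle[OF C'] un by blast
  moreover have "CARD('e) \<le> CARD('v) + 1"
    using card_Un_Int[of C C'] card_Un_Int[of "verts D C" "verts D C'"]
      oriented_cycle_card_verts[OF C] oriented_cycle_card_verts[OF C'] by (simp add: un x dis)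
  ultimately show ?thesis by (auto simp: bicyclic_def)
qed

text \<open>Connectedness spreads through the first vertex of the path. The shared path has one
  vertex more than edges, so inclusion-exclusion gives one more edge than vertices.\<close>

lemma bicyclic_if_share_path:
  fixes D :: "('v::finite, 'e::finite) wo_graph"
  assumes C: "oriented_cycle D C" and C': "oriented_cycle D C'" and sh: "share_path D C C'"
  shows "bicyclic D"
proof -
  obtain vs es where p: "oriented_path D vs es" and x: "verts D C \<inter> verts D C' = set vs"
    and dis: "C \<inter> C' = set es"
    and un: "C \<union> C' = UNIV" "verts D C \<union> verts D C' = UNIV"
    using sh by (auto simp: share_path_def)
  have vs: "vs \<noteq> []" "card (set vs) = Suc (card (set es))"
    using p oriented_path_distinct_edges[OF p] by (auto simp: oriented_path_def distinct_card)
  have "S = UNIV" if S: "S \<noteq> {}" "edge_closed D S" for S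
  proof -
    have "S \<inter> C \<noteq> {} \<or> S \<inter> C' \<noteq> {}" using S un by blast
    then have "C \<subseteq> S \<or> C' \<subseteq> S"
      using edge_closed_cycle[OF C S(2)] edge_closed_cycle[OF C' S(2)] edge_closed_meets[OF S(2)] by blast
    then have "hd vs \<in> verts D S" "hd vs \<in> verts D C \<inter> verts D C'"
      using x vs(1) verts_mono by (metis Int_iff hd_in_set subsetD, metis hd_in_set)
    then show ?thesis
      using edge_closed_cycle[OF C S(2)] edge_closed_cycle[OF C' S(2)] un by blast
  qed
  moreover have "2 \<le> card (star D UNIV v)" for v
    using degree_ge_2_if_in_cycle[OF C] degree_ge_2_if_in_cycle[OF C'] un by blast
  moreover have "CARD('e) \<le> CARD('v) + 1"
    using card_Un_Int[of C C'] card_Un_Int[of "verts D C" "verts D C'"]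
      oriented_cycle_card_verts[OF C] oriented_cycle_card_verts[OF C'] vs(2) by (simp add: un x dis)
  ultimately show ?thesis by (auto simp: bicyclic_def)
qed

text \<open>A nonempty closed set reaches the path, hence both of its ends and both cycles. Inner
  vertices of the path get their two edges from the path itself.\<close>

lemma bicyclic_if_connected_by_path:
  fixes D :: "('v::finite, 'e::finite) wo_graph"
  assumes C: "oriented_cycle D C" and C': "oriented_cycle D C'" and sh: "connected_by_path D C C'"
  shows "bicyclic D"
proof -
  obtain vs es where p: "oriented_path D vs es" and dis: "verts D C \<inter> verts D C' = {}"
    and hd: "verts D C \<inter> set vs = {hd vs}" and last: "verts D C' \<inter> set vs = {last vs}"
    and un: "C \<union> C' \<union> set es = UNIV" "verts D C \<union> verts D C' \<union> set vs = UNIV"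
    using sh by (auto simp: connected_by_path_def)
  have len: "length vs = Suc (length es)" and vs: "card (set vs) = Suc (length es)" "distinct vs"
    using p by (auto simp: oriented_path_def distinct_card)
  have hdC: "hd vs \<in> verts D C" "hd vs \<in> set vs" and lastC: "last vs \<in> verts D C'" "last vs \<in> set vs"
    using hd last by blast+
  have "S = UNIV" if S: "S \<noteq> {}" "edge_closed D S" for S
  proof -
    have path: "ends D e \<inter> set vs \<noteq> {}" if e: "e \<in> set es" for e
    proof -
      obtain i where "i < length es" "e = es ! i" using e by (auto simp: in_set_conv_nth)
      then have "vs ! i \<in> ends D e" "vs ! i \<in> set vs"
        using p by (auto simp: oriented_path_def)
      then show ?thesis by blast
    qed
    have "S \<inter> C \<noteq> {} \<or> S \<inter> C' \<noteq> {} \<or> S \<inter> set es \<noteq> {}" using S un by blast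
    then have "verts D S \<inter> set vs \<noteq> {}"
    proof (elim disjE)
      assume "S \<inter> C \<noteq> {}"
      then have "C \<subseteq> S" using edge_closed_cycle[OF C S(2)] edge_closed_meets[OF S(2)] by blast
      then show ?thesis using hdC verts_mono[of C S D] by blast
    next
      assume "S \<inter> C' \<noteq> {}"
      then have "C' \<subseteq> S" using edge_closed_cycle[OF C' S(2)] edge_closed_meets[OF S(2)] by blast
      then show ?thesis using lastC verts_mono[of C' S D] by blast
    next
      assume "S \<inter> set es \<noteq> {}"
      then obtain e where "e \<in> S" "e \<in> set es" by blast
      then have "ends D e \<subseteq> verts D S" "ends D e \<inter> set vs \<noteq> {}"
        using path by (auto simp: verts_def)
      then show ?thesis by blast
    qed
    then obtain x where x: "x \<in> set vs" "x \<in> verts D S" by blast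
    have "hd vs \<in> verts D S" "last vs \<in> verts D S"
      using edge_closed_path(1)[OF p S(2) x] hdC lastC by blast+
    then have "C \<subseteq> S" "C' \<subseteq> S"
      using edge_closed_cycle[OF C S(2)] edge_closed_cycle[OF C' S(2)] hdC lastC by blast+
    then show ?thesis
      using edge_closed_path(2)[OF p S(2) x] un(1) by blast
  qed
  moreover have "2 \<le> card (star D UNIV v)" for v
  proof (cases "v \<in> verts D C \<or> v \<in> verts D C'")
    case True
    then show ?thesis
      using degree_ge_2_if_in_cycle[OF C] degree_ge_2_if_in_cycle[OF C'] by blast
  next
    case False
    then have v: "v \<in> set vs" "v \<noteq> hd vs" "v \<noteq> last vs" using un(2) hdC lastC by blast+
    then obtain i where i: "i < length vs" "v = vs ! i" by (auto simp: in_set_conv_nth)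
    moreover have "i \<noteq> 0" using v(2) i hd_conv_nth[of vs] by (metis length_0_conv not_less_zero)
    moreover have "i \<noteq> length es"
    proof
      assume "i = length es"
      moreover have "vs \<noteq> []" using len by auto
      ultimately have "v = last vs" using i len by (simp add: last_conv_nth)
      then show False using v by blast
    qed
    \<comment> \<open>An inner vertex has a path edge on either side, at positions \<open>k\<close>
      and \<open>Suc k\<close>.\<close>
    ultimately obtain k where k: "i = Suc k" "Suc k < length es"
      using len i(1) by (metis Suc_lessI less_Suc_eq not0_implies_Suc)
    then have "{es ! k, es ! Suc k} \<subseteq> star D UNIV v"
      using p i k by (simp add: oriented_path_def)
    moreover have "es ! k \<noteq> es ! Suc k"
      using oriented_path_distinct_edges[OF p] k by (simp add: nth_eq_iff_index_eq)
    ultimately show ?thesis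
      using card_mono[of "star D UNIV v" "{es ! k, es ! Suc k}"] by simp
  qed
  moreover have "CARD('e) \<le> CARD('v) + 1"
  proof -
    \<comment> \<open>The ends of the path differ because the cycles are disjoint. With
      \<open>s\<close> edges, the path thus adds \<open>s - 1\<close> vertices to the cycles and at
      most \<open>s\<close> edges.\<close>
    have "(verts D C \<union> verts D C') \<inter> set vs = {hd vs, last vs}" "hd vs \<noteq> last vs"
      using hd last dis by blast+
    then have "CARD('v) + 2 = card C + card C' + Suc (length es)"
      using card_Un_Int[of "verts D C" "verts D C'"] card_Un_Int[of "verts D C \<union> verts D C'" "set vs"]
        oriented_cycle_card_verts[OF C] oriented_cycle_card_verts[OF C'] by (simp add: un dis vs)
    moreover have "CARD('e) \<le> card C + card C' + length es"
      using card_Un_le[of "C \<union> C'" "set es"] card_Un_le[of C C'] card_length[of es] by (simp add: un)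
    ultimately show ?thesis by simp
  qed
  ultimately show ?thesis unfolding bicyclic_def by blast
qed

section \<open>Regular subgraphs\<close>

text \<open>
  Adding the missing edges one at a time, each meeting the current subgraph, never decreases
  the number of edges minus the number of vertices, and the last one adds no vertex, as every
  vertex has degree at least two.
\<close>

lemma bicyclic_card_subgraph:
  fixes D :: "('v::finite, 'e::finite) wo_graph"
  assumes D: "bicyclic D" "weighted_oriented_graph D"
    and "S \<noteq> {}" "S \<noteq> UNIV"
  shows "card S \<le> card (verts D S)"
  using assms(3,4)
proof (induction "card (- S)" arbitrary: S rule: less_induct)
  case less
  have con: "\<And>S. S \<noteq> {} \<Longrightarrow> edge_closed D S \<Longrightarrow> S = UNIV"
    and deg: "\<And>v. 2 \<le> card (star D UNIV v)" and card: "CARD('e) \<le> CARD('v) + 1"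
    using D(1) by (auto simp: bicyclic_def)
  obtain e where e: "e \<notin> S" "ends D e \<inter> verts D S \<noteq> {}"
    using con[OF less(2)] less(3) by (auto simp: edge_closed_def)
  have cS: "card (insert e S) = Suc (card S)" using e by simp
  show ?case
  proof (cases "insert e S = UNIV")
    case True
    have "v \<in> verts D S" for v
    proof -
      have "\<not> star D UNIV v \<subseteq> {e}"
        using deg[of v] card_mono[of "{e}" "star D UNIV v"] by auto
      then show ?thesis using True by (auto simp: verts_def)
    qed
    then have "verts D S = UNIV" by auto
    then show ?thesis using cS card by (simp add: True)
  next
    case False
    have "card (- insert e S) < card (- S)"
      using e by (intro psubset_card_mono) auto
    then have "card (insert e S) \<le> card (verts D (insert e S))"
      using less(1) False by blast
    also have "verts D (insert e S) = ends D e \<union> verts D S" by (auto simp: verts_def)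
    also have "card \<dots> \<le> Suc (card (verts D S))"
    proof -
      have "finite (ends D e)" by (simp add: ends_def)
      moreover have "card (ends D e \<inter> verts D S) > 0"
        using e(2) by (simp add: card_gt_0_iff)
      ultimately show ?thesis
        using card_Un_Int[of "ends D e" "verts D S"] card_ends[OF D(2), of e] by simp
    qed
    finally show ?thesis using cS by simp
  qed
qed

text \<open>The degrees sum to twice the number of edges, hence to at most twice the number of
  vertices; as none is below 2, none can exceed 2.\<close>

lemma two_regular_if_card_le:
  fixes D :: "('v::finite, 'e::finite) wo_graph"
  assumes D: "weighted_oriented_graph D" and le: "card S \<le> card (verts D S)"
    and deg: "\<And>v. v \<in> verts D S \<Longrightarrow> 2 \<le> card (star D S v)"
    and v: "v \<in> verts D S"
  shows "card (star D S v) = 2"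
proof (rule ccontr)
  assume "card (star D S v) \<noteq> 2"
  then have "2 < card (star D S v)" using deg[OF v] by simp
  then have "(\<Sum>v\<in>verts D S. 2) < (\<Sum>v\<in>verts D S. card (star D S v))"
    using deg v by (intro sum_strict_mono_ex1) auto
  also have "\<dots> = 2 * card S"
  \<comment> \<open>Double counting of incidences: each edge of \<open>S\<close> is counted at its
    two ends.\<close>
  proof (rule sum_multicount, simp_all, intro ballI)
    fix e assume "e \<in> S"
    then have "{v \<in> verts D S. v \<in> ends D e} = ends D e" by (auto simp: verts_def)
    then show "card {v \<in> verts D S. v \<in> ends D e} = 2" using card_ends[OF D] by simp
  qed
  finally show False using le by simp
qed

text \<open>
  The second edge at the first vertex of a longest path must end on that path.
\<close>

lemma min_degree_2_contains_cycle:
  fixes D :: "('v::finite, 'e::finite) wo_graph"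
  assumes D: "weighted_oriented_graph D" and "S \<noteq> {}"
    and deg: "\<And>v. v \<in> verts D S \<Longrightarrow> 2 \<le> card (star D S v)"
  obtains vs es where "cycle_labelling D vs es" "set es \<subseteq> S"
proof -
  define P where "P n \<longleftrightarrow> (\<exists>vs es. oriented_path D vs es \<and> set es \<subseteq> S \<and> length es = n)" for n
  have D': "tail D e \<noteq> head D e" "ends D e = ends D e' \<Longrightarrow> e = e'" for e e'
    using D by (auto simp: weighted_oriented_graph_def inj_def)
  obtain e0 where "e0 \<in> S" using \<open>S \<noteq> {}\<close> by blast
  then have P1: "P 1"
    unfolding P_def using D'(1)[of e0]
    by (intro exI[of _ "[tail D e0, head D e0]"] exI[of _ "[e0]"]) (simp_all add: oriented_path_def ends_def)
  have bound: "n \<le> CARD('v)" if n: "P n" for n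
  proof -
    obtain vs es where "oriented_path D vs es" "length es = n" using n by (auto simp: P_def)
    then show ?thesis
      using card_mono[of UNIV "set vs"] by (auto simp: oriented_path_def distinct_card)
  qed
  \<comment> \<open>A longest path exists, since the distinct vertices bound the length of a
    path.\<close>
  obtain n where n: "P n" and max: "\<And>k. P k \<Longrightarrow> k \<le> n"
  proof -
    have "\<exists>n. P n \<and> (\<forall>k. P k \<longrightarrow> id k \<le> id n)"
      using P1 by (rule ex_has_greatest_nat[where b = "Suc CARD('v)"]) (auto simp: less_Suc_eq_le bound)
    then show ?thesis using that by auto
  qed
  have "n \<ge> 1" using max[OF P1] .
  obtain vs es where p: "oriented_path D vs es" and sub: "set es \<subseteq> S" and len: "length es = n"
    using n by (auto simp: P_def)
  have vs: "length vs = Suc n" "distinct vs"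
    and ends: "\<And>i. i < n \<Longrightarrow> ends D (es ! i) = {vs ! i, vs ! Suc i}"
    using p len by (auto simp: oriented_path_def)
  have e0: "es ! 0 \<in> star D S (vs ! 0)"
  proof -
    have "0 < length es" using len \<open>n \<ge> 1\<close> by linarith
    then have "es ! 0 \<in> S" using sub nth_mem by blast
    then show ?thesis using ends[of 0] \<open>n \<ge> 1\<close> by simp
  qed
  then have "vs ! 0 \<in> verts D S" by (auto simp: verts_def)
  then have "\<not> star D S (vs ! 0) \<subseteq> {es ! 0}"
    using deg[of "vs ! 0"] card_mono[of "{es ! 0}" "star D S (vs ! 0)"] by auto
  then obtain e where e: "e \<in> S" "vs ! 0 \<in> ends D e" "e \<noteq> es ! 0" by auto
  obtain y where y: "ends D e = {vs ! 0, y}" "y \<noteq> vs ! 0"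
  proof (cases "vs ! 0 = tail D e")
    case True
    then show ?thesis using that[of "head D e"] D'(1)[of e] by (auto simp: ends_def)
  next
    case False
    then show ?thesis using that[of "tail D e"] e(2) by (auto simp: ends_def)
  qed
  have "y \<in> set vs"
  proof (rule ccontr)
    \<comment> \<open>Otherwise prepending \<open>e\<close> would give a longer path.\<close>
    assume y': "y \<notin> set vs"
    have "ends D ((e # es) ! i) = {(y # vs) ! i, (y # vs) ! Suc i}" if "i < Suc n" for i
      using ends y(1) that by (cases i) auto
    then have "oriented_path D (y # vs) (e # es)"
      using y' vs len by (simp add: oriented_path_def)
    then have "P (Suc n)"
      unfolding P_def using e(1) sub len
      by (intro exI[of _ "y # vs"] exI[of _ "e # es"]) auto
    then show False using max[of "Suc n"] by simp
  qed
  then obtain k where k: "k < Suc n" "y = vs ! k" using vs by (auto simp: in_set_conv_nth)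
  have "k \<noteq> 0" using y(2) k(2) by (intro notI) simp
  \<comment> \<open>For \<open>k = 1\<close> the edge \<open>e\<close> would be parallel to
    \<open>es ! 0\<close>, contrary to simplicity. Hence the cycle to be closed has at least three
    vertices.\<close>
  moreover have "k \<noteq> 1"
  proof
    assume "k = 1"
    then have "ends D e = ends D (es ! 0)" using y(1) k(2) ends[of 0] \<open>n \<ge> 1\<close> by simp
    then show False using D'(2) e(3) by blast
  qed
  ultimately have k2: "k \<ge> 2" by simp
  \<comment> \<open>The initial segment of the path up to \<open>y\<close> is closed to a cycle by
    \<open>e\<close>.\<close>
  have "cycle_labelling D (take (Suc k) vs) (take k es @ [e])"
    unfolding cycle_labelling_def
  proof (intro conjI allI impI)
    show "3 \<le> length (take (Suc k) vs)" "length (take k es @ [e]) = length (take (Suc k) vs)"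
      using k k2 vs len by auto
    show "distinct (take (Suc k) vs)" using vs by simp
  next
    fix i assume "i < length (take (Suc k) vs)"
    then have i: "i < Suc k" by simp
    have l: "length (take (Suc k) vs) = Suc k" using k vs by simp
    show "ends D ((take k es @ [e]) ! i) =
        {take (Suc k) vs ! i, take (Suc k) vs ! (Suc i mod length (take (Suc k) vs))}"
    proof (cases "i = k")
      case True
      have "(take k es @ [e]) ! k = e" using k(1) len by (simp add: nth_append)
      then show ?thesis unfolding True l using y(1) k(2) by (simp add: insert_commute)
    next
      case False
      then have "i < k" using i by simp
      moreover from this have "(take k es @ [e]) ! i = es ! i" using k(1) len by (simp add: nth_append)
      ultimately show ?thesis unfolding l using ends[of i] k(1) by simp
    qed
  qed
  moreover have "set (take k es @ [e]) \<subseteq> S" using e(1) sub set_take_subset[of k es] by auto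
  ultimately show thesis using that by blast
qed

section \<open>Supports of kernel vectors\<close>

lemma kernel_vector_degree:
  fixes D :: "('v::finite, 'e::finite) wo_graph"
  assumes D: "weighted_oriented_graph D" and u: "kernel_vector D u"
    and v: "v \<in> verts D {e. u e \<noteq> 0}"
  shows "2 \<le> card (star D {e. u e \<noteq> 0} v)"
proof (rule ccontr)
  let ?S = "{e. u e \<noteq> 0}"
  assume "\<not> ?thesis"
  moreover obtain e where e: "e \<in> star D ?S v" using v by (auto simp: verts_def)
  then have "card (star D ?S v) > 0" by (metis card_gt_0_iff empty_iff finite)
  ultimately have "card (star D ?S v) = 1" by simp
  \<comment> \<open>With only one support edge at \<open>v\<close>, the kernel equation at
    \<open>v\<close> would consist of a single nonzero term.\<close>
  then have "star D ?S v = {e}" using e by (metis card_1_singletonE singletonD)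
  moreover have "(\<Sum>e\<in>UNIV. int (incidence D v e) * u e) =
      (\<Sum>e\<in>star D ?S v. int (incidence D v e) * u e)"
    by (rule kernel_vector_sum_star[OF D]) blast
  ultimately have "(\<Sum>e\<in>UNIV. int (incidence D v e) * u e) = int (incidence D v e) * u e"
    by (simp only: sum.insert sum.empty finite.emptyI empty_iff not_False_eq_True add_0_right)
  then show False
    using u e incidence_eq_0_iff[OF D, of v e] by (auto simp: kernel_vector_def)
qed

text \<open>It is applied in contrapositive form: without balanced cycles, a nonzero kernel vector
  has full support.\<close>

lemma balanced_cycle_if_kernel_vector:
  fixes D :: "('v::finite, 'e::finite) wo_graph"
  assumes D: "weighted_oriented_graph D" "bicyclic D" and u: "kernel_vector D u"
    and "{e. u e \<noteq> 0} \<noteq> {}" "{e. u e \<noteq> 0} \<noteq> UNIV"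
  obtains C where "oriented_cycle D C" "balanced D C"
proof -
  let ?S = "{e. u e \<noteq> 0}"
  note deg = kernel_vector_degree[OF D(1) u]
  have reg: "card (star D ?S v) = 2" if "v \<in> verts D ?S" for v
    using two_regular_if_card_le[OF D(1) bicyclic_card_subgraph[OF D(2,1) assms(4,5)] deg that] .
  obtain vs es where c: "cycle_labelling D vs es" "set es \<subseteq> ?S"
    using min_degree_2_contains_cycle[OF D(1) assms(4) deg] by blast
  then have "balanced D (set es)"
    using balanced_if_kernel_vector[OF D(1) u] reg by blast
  then show thesis using that c(1) by (auto simp: oriented_cycle_def)
qed

section \<open>The support of the generator\<close>

theorem corollary5p3:
  fixes D :: "('v::finite, 'e::finite) wo_graph"
    and Cm Cn :: "'e set"
    and f :: "('e, 'k::field) mpoly"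
  assumes "weighted_oriented_graph D"
    and "oriented_cycle D Cm" and "oriented_cycle D Cn" and "Cm \<noteq> Cn"
    and "share_vertex D Cm Cn \<or> share_path D Cm Cn \<or> connected_by_path D Cm Cn"
    and "is_binomial f" and "irreducible f"
    and "toric_ideal D = ideal_generated {f}"
  shows "(\<forall>C. oriented_cycle D C \<and> balanced D C \<longrightarrow> supp f = C) \<and>
         ((\<nexists>C. oriented_cycle D C \<and> balanced D C) \<longrightarrow> supp f = UNIV)"
proof -
  obtain r s where rs: "\<And>x. Poly_Mapping.lookup r x = 0 \<or> Poly_Mapping.lookup s x = 0"
    and f: "f = monomial r - monomial s"
    using assms(6) unfolding is_binomial_def by blast
  define u where "u = exponent_diff r s"
  have "f \<noteq> 0" using assms(7) by (simp add: irreducible_def)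
  then have "r \<noteq> s" using f by auto
  then have supp: "supp f = {e. u e \<noteq> 0}"
    unfolding f u_def by (rule supp_binomial[OF rs])
  have "f \<in> ideal_generated {f}"
  proof -
    interpret module "(*) :: ('e, 'k) mpoly \<Rightarrow> _"
      by standard (simp_all add: algebra_simps)
    show ?thesis unfolding ideal_generated_def by (rule span_base) simp
  qed
  then have "f \<in> toric_ideal D" by (simp only: assms(8))
  then have u: "kernel_vector D u"
    unfolding f u_def by (rule binomial_in_toric_ideal_iff_kernel_vector[OF assms(1), THEN iffD1])
  have nonzero: "{e. u e \<noteq> 0} \<noteq> {}"
  proof
    assume "{e. u e \<noteq> 0} = {}"
    then have "Poly_Mapping.lookup r e = Poly_Mapping.lookup s e" for e
      by (auto simp: u_def exponent_diff_def)
    then show False using \<open>r \<noteq> s\<close> poly_mapping_eqI by blast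
  qed
  have "bicyclic D"
    using assms(5) bicyclic_if_share_vertex[OF assms(2,3)] bicyclic_if_share_path[OF assms(2,3)]
      bicyclic_if_connected_by_path[OF assms(2,3)] by blast
  have "supp f = C" if C: "oriented_cycle D C" "balanced D C" for C
  proof -
    obtain z where z: "kernel_vector D z" "{e. z e \<noteq> 0} = C"
      using kernel_vector_if_balanced[OF assms(1) C(2)] by blast
    \<comment> \<open>The exponents \<open>a\<close> and \<open>b\<close> are the positive and
      negative parts of \<open>z\<close>, with \<open>nat\<close> cutting off negative
      values.\<close>
    define a where "a = Abs_poly_mapping (\<lambda>e. nat (z e))"
    define b where "b = Abs_poly_mapping (\<lambda>e. nat (- z e))"
    have ab: "exponent_diff a b = z"
      by (rule ext) (simp add: exponent_diff_def a_def b_def)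
    have "(monomial a - monomial b :: ('e, 'k) mpoly) \<in> toric_ideal D"
      unfolding binomial_in_toric_ideal_iff_kernel_vector[OF assms(1)] ab by (rule z(1))
    then obtain k where k: "\<And>e. z e = k * u e"
      using exponent_diff_in_principal_ideal[of a b r s] unfolding assms(8) f ab u_def by blast
    \<comment> \<open>The support of \<open>z\<close> is the nonempty cycle \<open>C\<close>; a
      nonzero factor \<open>k\<close> then gives \<open>u\<close> the same support.\<close>
    have "k \<noteq> 0"
      using z(2) k oriented_cycle_nonempty[OF C(1)] by auto
    then show ?thesis unfolding supp z(2)[symmetric] k by simp
  qed
  moreover have "supp f = UNIV" if "\<nexists>C. oriented_cycle D C \<and> balanced D C"
    using balanced_cycle_if_kernel_vector[OF assms(1) \<open>bicyclic D\<close> u nonzero] that supp by metis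
  ultimately show ?thesis by blast
qed

end
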